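(* Let $\mathfrak{g}$ be an abelian real Lie algebra with basis $\{\partial_1,\dots,\partial_n\}$ and let $(C_{\mathcal{A}},h)$ be a real metric calculus such that $$C_{\mathcal{A}}=(\mathrm{Mat}_N(\mathbb{C}),\mathfrak{g}_D,(\mathbb{C}^N)^n,\varphi)$$ and $\varphi(\partial_i)=(0,\dots,0,\alpha_iv_0,0,\dots,0)\in(\mathbb{C}^N)^n$ (with $\alpha_iv_0$ in the $i$-th position), where $\alpha_i\in\mathbb{R}\setminus\{0\}$ and $v_0\in\mathbb{C}^N$ is a unit vector. Then there exists a unique connection $\nabla$ such that $(C_{\mathcal{A}},h,\nabla)$ is pseudo-Riemannian if and only if $v_0$ is an eigenvector of $\hat{D}(\partial_i)$ with eigenvalue $\lambda_i$ (i.e. $v_0\hat{D}(\partial_i)=\lambda_iv_0$ for some $\lambda_i\in\mathbb{C}$) for $i=1,\dots,n$. In this case, the Levi-Civita connection $\nabla$ is given by $$\nabla_{\partial_i}v=\lambda_iv-v\cdot\hat{D}(\partial_i)$$ for $v\in(\mathbb{C}^N)^n$.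
   Context: A hermitian derivation of a unital complex $*$-algebra $\mathcal{A}$ is a derivation $d$ with $d(a^* )=d(a)^*$. $\mathrm{Mat}_N(\mathbb{C})$ has conjugate transpose as its involution. $\mathbb{C}^N$ consists of row vectors and $(\mathbb{C}^N)^n$ is a right $\mathrm{Mat}_N(\mathbb{C})$-module via $(v_1,\dots,v_n)\cdot A=(v_1A,\dots,v_nA)$. Real calculus $(\mathcal{A},\mathfrak{g}_D,M,\varphi)$: $\mathcal{A}$ a unital $*$-algebra, $\mathfrak{g}$ a real Lie algebra with a faithful representation $D:\mathfrak{g}\to\mathrm{Der}(\mathcal{A})$ by hermitian derivations (write $\partial(a)=D(\partial)(a)$), $M$ a right $\mathcal{A}$-module, $\varphi:\mathfrak{g}\to M$ an $\mathbb{R}$-linear map whose image generates $M$ as an $\mathcal{A}$-module. A metric on $M$ is a map $h:M\times M\to\mathcal{A}$, additive in the second argument, with $h(m_1,m_2a)=h(m_1,m_2)a$, $h(m_1,m_2)=h(m_2,m_1)^*$, and nondegenerate ($h(m_1,m_2)=0$ for all $m_2$ implies $m_1=0$). $(C_{\mathcal{A}},h)$ is a real metric calculus if $h$ is a metric and $h(\varphi(\partial),\varphi(\partial'))$ is self-adjoint for all $\partial,\partial'\in\mathfrak{g}$. An affine connection is a map $\nabla:\mathfrak{g}\times M\to M$, $(\partial,m)\mapsto\nabla_\partial m$, additive in $m$, $\mathbb{R}$-linear in $\partial$, with $\nabla_\partial(ma)=(\nabla_\partial m)a+m\partial(a)$. $(C_{\mathcal{A}},h,\nabla)$ is a real connection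 calculus if $h(\nabla_\partial\varphi(\partial'),\varphi(\partial''))$ is self-adjoint for all $\partial,\partial',\partial''\in\mathfrak{g}$. It is pseudo-Riemannian (and $\nabla$ is then called a Levi-Civita connection) if moreover it is metric, $\partial(h(m,n))=h(\nabla_\partial m,n)+h(m,\nabla_\partial n)$ for all $\partial\in\mathfrak g$, $m,n\in M$, and torsion-free, $\nabla_{\partial}\varphi(\partial')-\nabla_{\partial'}\varphi(\partial)-\varphi([\partial,\partial'])=0$ for all $\partial,\partial'\in\mathfrak{g}$. $\hat{D}(\partial)\in\mathrm{Mat}_N(\mathbb{C})$ is the unique trace-free matrix with $D(\partial)=[\hat{D}(\partial),\cdot]$; it is anti-hermitian. Eigenvectors are understood as row (left) eigenvectors. *)

theory Defs
  imports "HOL-Analysis.Analysis"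
begin

section \<open>Real calculi\<close>

locale unital_star_algebra = vector_space scale
  for scale :: "complex \<Rightarrow> 'a::ab_group_add \<Rightarrow> 'a" +
  fixes mul :: "'a \<Rightarrow> 'a \<Rightarrow> 'a"  (infixl \<open>\<odot>\<close> 70)
    and one :: 'a
    and star :: "'a \<Rightarrow> 'a"
  assumes mul_assoc: "(a \<odot> b) \<odot> c = a \<odot> (b \<odot> c)"
    and mul_add_left: "(a + b) \<odot> c = a \<odot> c + b \<odot> c"
    and mul_add_right: "a \<odot> (b + c) = a \<odot> b + a \<odot> c"
    and mul_scale_left: "scale z a \<odot> b = scale z (a \<odot> b)"
    and mul_scale_right: "a \<odot> scale z b = scale z (a \<odot> b)"
    and one_left: "one \<odot> a = a"
    and one_right: "a \<odot> one = a"
    and star_star: "star (star a) = a"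
    and star_add: "star (a + b) = star a + star b"
    and star_scale: "star (scale z a) = scale (cnj z) (star a)"
    and star_mul: "star (a \<odot> b) = star b \<odot> star a"
begin

definition self_adjoint :: "'a \<Rightarrow> bool" where
  "self_adjoint a \<longleftrightarrow> star a = a"

definition derivation :: "('a \<Rightarrow> 'a) \<Rightarrow> bool" where
  "derivation d \<longleftrightarrow>
     (\<forall>a b. d (a + b) = d a + d b) \<and>
     (\<forall>z a. d (scale z a) = scale z (d a)) \<and>
     (\<forall>a b. d (a \<odot> b) = d a \<odot> b + a \<odot> d b)"

definition hermitian_derivation :: "('a \<Rightarrow> 'a) \<Rightarrow> bool" where
  "hermitian_derivation d \<longleftrightarrow> derivation d \<and> (\<forall>a. d (star a) = star (d a))"

end

locale real_lie_algebra =
  fixes bracket :: "'g::real_vector \<Rightarrow> 'g \<Rightarrow> 'g"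
  assumes bracket_bilinear: "bilinear bracket"
    and bracket_self: "bracket x x = 0"
    and jacobi: "bracket x (bracket y z) + bracket y (bracket z x) + bracket z (bracket x y) = 0"

locale right_module_over = unital_star_algebra scale mul one star
  for scale :: "complex \<Rightarrow> 'a::ab_group_add \<Rightarrow> 'a"
    and mul :: "'a \<Rightarrow> 'a \<Rightarrow> 'a"  (infixl \<open>\<odot>\<close> 70)
    and one :: 'a
    and star :: "'a \<Rightarrow> 'a" +
  fixes act :: "'m::ab_group_add \<Rightarrow> 'a \<Rightarrow> 'm"  (infixl \<open>\<lhd>\<close> 70)
  assumes act_add_left: "(m + m') \<lhd> a = m \<lhd> a + m' \<lhd> a"
    and act_add_right: "m \<lhd> (a + b) = m \<lhd> a + m \<lhd> b"
    and act_mul: "m \<lhd> (a \<odot> b) = (m \<lhd> a) \<lhd> b"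
    and act_one: "m \<lhd> one = m"
begin

text \<open>A right module over a unital complex algebra carries only the real vector space structure
  \<open>r m = m (r 1)\<close>; real linearity of maps into the module refers to it.\<close>

definition real_scale :: "real \<Rightarrow> 'm \<Rightarrow> 'm" where
  "real_scale r m = m \<lhd> scale (complex_of_real r) one"

definition submodule :: "'m set \<Rightarrow> bool" where
  "submodule S \<longleftrightarrow>
     0 \<in> S \<and> (\<forall>m\<in>S. \<forall>m'\<in>S. m + m' \<in> S) \<and> (\<forall>m\<in>S. \<forall>a. m \<lhd> a \<in> S)"

end

locale real_calculus =
  right_module_over scale mul one star act + real_lie_algebra bracket
  for scale :: "complex \<Rightarrow> 'a::ab_group_add \<Rightarrow> 'a"
    and mul :: "'a \<Rightarrow> 'a \<Rightarrow> 'a"  (infixl \<open>\<odot>\<close> 70)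
    and one :: 'a
    and star :: "'a \<Rightarrow> 'a"
    and act :: "'m::ab_group_add \<Rightarrow> 'a \<Rightarrow> 'm"  (infixl \<open>\<lhd>\<close> 70)
    and bracket :: "'g::real_vector \<Rightarrow> 'g \<Rightarrow> 'g" +
  fixes D :: "'g \<Rightarrow> 'a \<Rightarrow> 'a"
    and \<phi> :: "'g \<Rightarrow> 'm"
  assumes D_hermitian: "hermitian_derivation (D x)"
    and D_add: "D (x + y) a = D x a + D y a"
    and D_scaleR: "D (r *\<^sub>R x) a = scale (complex_of_real r) (D x a)"
    and D_bracket: "D (bracket x y) a = D x (D y a) - D y (D x a)"
    and D_faithful: "inj D"
    and phi_add: "\<phi> (x + y) = \<phi> x + \<phi> y"
    and phi_scaleR: "\<phi> (r *\<^sub>R x) = real_scale r (\<phi> x)"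
    and phi_generates: "submodule hull range \<phi> = UNIV"

locale real_metric_calculus =
  real_calculus scale mul one star act bracket D \<phi>
  for scale :: "complex \<Rightarrow> 'a::ab_group_add \<Rightarrow> 'a"
    and mul :: "'a \<Rightarrow> 'a \<Rightarrow> 'a"  (infixl \<open>\<odot>\<close> 70)
    and one :: 'a
    and star :: "'a \<Rightarrow> 'a"
    and act :: "'m::ab_group_add \<Rightarrow> 'a \<Rightarrow> 'm"  (infixl \<open>\<lhd>\<close> 70)
    and bracket :: "'g::real_vector \<Rightarrow> 'g \<Rightarrow> 'g"
    and D :: "'g \<Rightarrow> 'a \<Rightarrow> 'a"
    and \<phi> :: "'g \<Rightarrow> 'm" +
  fixes h :: "'m \<Rightarrow> 'm \<Rightarrow> 'a"
  assumes h_add_right: "h m (n + n') = h m n + h m n'"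
    and h_act_right: "h m (n \<lhd> a) = h m n \<odot> a"
    and h_star: "h m n = star (h n m)"
    and h_nondegenerate: "(\<And>n. h m n = 0) \<Longrightarrow> m = 0"
    and h_phi_self_adjoint: "self_adjoint (h (\<phi> x) (\<phi> y))"

locale real_connection_calculus =
  real_metric_calculus scale mul one star act bracket D \<phi> h
  for scale :: "complex \<Rightarrow> 'a::ab_group_add \<Rightarrow> 'a"
    and mul :: "'a \<Rightarrow> 'a \<Rightarrow> 'a"  (infixl \<open>\<odot>\<close> 70)
    and one :: 'a
    and star :: "'a \<Rightarrow> 'a"
    and act :: "'m::ab_group_add \<Rightarrow> 'a \<Rightarrow> 'm"  (infixl \<open>\<lhd>\<close> 70)
    and bracket :: "'g::real_vector \<Rightarrow> 'g \<Rightarrow> 'g"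
    and D :: "'g \<Rightarrow> 'a \<Rightarrow> 'a"
    and \<phi> :: "'g \<Rightarrow> 'm"
    and h :: "'m \<Rightarrow> 'm \<Rightarrow> 'a" +
  fixes nabla :: "'g \<Rightarrow> 'm \<Rightarrow> 'm"
  assumes nabla_add_right: "nabla x (m + n) = nabla x m + nabla x n"
    and nabla_add_left: "nabla (x + y) m = nabla x m + nabla y m"
    and nabla_scaleR_left: "nabla (r *\<^sub>R x) m = real_scale r (nabla x m)"
    and nabla_leibniz: "nabla x (m \<lhd> a) = nabla x m \<lhd> a + m \<lhd> D x a"
    and h_nabla_self_adjoint: "self_adjoint (h (nabla x (\<phi> y)) (\<phi> z))"

locale pseudo_riemannian_calculus =
  real_connection_calculus scale mul one star act bracket D \<phi> h nabla
  for scale :: "complex \<Rightarrow> 'a::ab_group_add \<Rightarrow> 'a"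
    and mul :: "'a \<Rightarrow> 'a \<Rightarrow> 'a"  (infixl \<open>\<odot>\<close> 70)
    and one :: 'a
    and star :: "'a \<Rightarrow> 'a"
    and act :: "'m::ab_group_add \<Rightarrow> 'a \<Rightarrow> 'm"  (infixl \<open>\<lhd>\<close> 70)
    and bracket :: "'g::real_vector \<Rightarrow> 'g \<Rightarrow> 'g"
    and D :: "'g \<Rightarrow> 'a \<Rightarrow> 'a"
    and \<phi> :: "'g \<Rightarrow> 'm"
    and h :: "'m \<Rightarrow> 'm \<Rightarrow> 'a"
    and nabla :: "'g \<Rightarrow> 'm \<Rightarrow> 'm" +
  assumes nabla_metric: "D x (h m n) = h (nabla x m) n + h m (nabla x n)"
    and nabla_torsion_free: "nabla x (\<phi> y) - nabla y (\<phi> x) - \<phi> (bracket x y) = 0"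


section \<open>The matrix algebra and its module of tuples of row vectors\<close>

text \<open>The type of square matrices carries the componentwise product as its
  class multiplication; the algebra product is \<open>(**)\<close>.\<close>

definition mat_scale :: "complex \<Rightarrow> complex^'N^'N \<Rightarrow> complex^'N^'N" where
  "mat_scale z A = (\<chi> i j. z * A $ i $ j)"

definition conj_transpose :: "complex^'N^'N \<Rightarrow> complex^'N^'N" where
  "conj_transpose A = (\<chi> i j. cnj (A $ j $ i))"

definition row_act :: "complex^'N^'n \<Rightarrow> complex^'N^'N \<Rightarrow> complex^'N^'n" where
  "row_act v A = (\<chi> i. v $ i v* A)"

definition row_scale :: "complex \<Rightarrow> complex^'N^'n \<Rightarrow> complex^'N^'n" where
  "row_scale z v = (\<chi> i. z *s v $ i)"

text \<open>Meaningful for derivations \<open>d\<close> of the matrix algebra: these are all inner, and the implementing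
  matrix is determined up to adding a scalar matrix, hence by its trace.\<close>

definition trace_free_matrix :: "(complex^'N^'N \<Rightarrow> complex^'N^'N) \<Rightarrow> complex^'N^'N" where
  "trace_free_matrix d = (THE X. trace X = 0 \<and> (\<forall>A. d A = X ** A - A ** X))"

lemma unital_star_algebra_mat:
  "unital_star_algebra mat_scale (**) (mat 1) (conj_transpose :: complex^'N^'N \<Rightarrow> _)"
proof unfold_locales
  fix A B C :: "complex^'N^'N" and z w :: complex
  show "A ** B ** C = A ** (B ** C)" by (simp add: matrix_mul_assoc)
  show "(A + B) ** C = A ** C + B ** C" "A ** (B + C) = A ** B + A ** C"
    by (simp_all add: vec_eq_iff matrix_matrix_mult_def algebra_simps sum.distrib)
  show "mat_scale z A ** B = mat_scale z (A ** B)" "A ** mat_scale z B = mat_scale z (A ** B)"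
    by (simp_all add: vec_eq_iff mat_scale_def matrix_matrix_mult_def sum_distrib_left ac_simps)
  show "conj_transpose (A ** B) = conj_transpose B ** conj_transpose A"
    by (simp add: vec_eq_iff conj_transpose_def matrix_matrix_mult_def ac_simps)
qed (simp_all add: vec_eq_iff mat_scale_def conj_transpose_def algebra_simps)

lemma right_module_over_mat:
  "right_module_over mat_scale (**) (mat 1) conj_transpose
     (row_act :: complex^'N^'n \<Rightarrow> complex^'N^'N \<Rightarrow> _)"
proof -
  interpret unital_star_algebra mat_scale "(**)" "mat 1" "conj_transpose :: complex^'N^'N \<Rightarrow> _"
    by (rule unital_star_algebra_mat)
  show ?thesis
  proof unfold_locales
    fix m n :: "complex^'N^'n" and A B :: "complex^'N^'N"
    show "row_act m (A ** B) = row_act (row_act m A) B"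
      by (simp add: vec_eq_iff row_act_def vector_matrix_mul_assoc)
    show "row_act (m + n) A = row_act m A + row_act n A" "row_act m (A + B) = row_act m A + row_act m B"
      by (simp_all add: vec_eq_iff row_act_def vector_matrix_mult_def algebra_simps sum.distrib)
  qed (simp add: vec_eq_iff row_act_def)
qed

end

theory Submission
  imports Defs
begin

text \<open>The proof separates three facts about a real metric calculus from the computation that is
  specific to matrices.

  Uniqueness is the Koszul formula: torsion-freeness, metricity and self-adjointness of the elements
  \<open>h (\<nabla>\<^sub>x \<phi> y) (\<phi> z)\<close> express twice this element through \<open>h\<close>, \<open>D\<close> and the bracket. Since \<open>\<phi>\<close>
  generates the module and \<open>h\<close> is nondegenerate, this determines \<open>\<nabla>\<^sub>x \<phi> y\<close>, and the Leibniz rule then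
  determines \<open>\<nabla>\<close> (\<open>levi_civita_unique\<close>).

  Necessity uses the projection \<open>P\<close> onto the line of \<open>v0\<close>, which fixes every \<open>\<phi> y\<close>. Self-adjointness
  of \<open>h (\<nabla>\<^sub>x \<phi> y) (\<phi> z)\<close> moves \<open>P\<close> from the second argument to the first, so \<open>P\<close> also fixes
  \<open>\<nabla>\<^sub>x \<phi> y\<close>; the Leibniz rule applied to \<open>\<phi> y = \<phi> y P\<close> leaves \<open>\<phi> y (D x P) = 0\<close>
  (\<open>connection_kills_derivative_of_projection\<close>). As \<open>D x = [X, \<cdot>]\<close>, this says that
  \<open>v0 X = v0 X P\<close>, a multiple of \<open>v0\<close>.

  Sufficiency: if \<open>v0 X = \<lambda> v0\<close> then \<open>B = \<lambda> 1 - X\<close> is anti-hermitian, still satisfies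
  \<open>D x = [\<cdot>, B]\<close>, and annihilates every \<open>\<phi> y\<close>. Right multiplication by \<open>B\<close> is therefore a
  connection for which all \<open>\<phi> y\<close> are parallel, and it is pseudo-Riemannian because the Lie
  algebra is abelian (\<open>right_multiplication_pseudo_riemannian\<close>). With uniqueness this also yields the formula
  for the Levi-Civita connection.\<close>


section \<open>Real metric calculi\<close>

context unital_star_algebra
begin

lemma mul_zero_right: "a \<odot> 0 = 0"
  using mul_add_right[of a 0 0] by simp

lemma mul_zero_left: "0 \<odot> a = 0"
  using mul_add_left[of 0 0 a] by simp

lemma mul_minus_right: "a \<odot> (- b) = - (a \<odot> b)"
  using mul_add_right[of a b "- b"] by (simp add: mul_zero_right minus_unique)

lemma mul_minus_left: "(- a) \<odot> b = - (a \<odot> b)"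
  using mul_add_left[of a "- a" b] by (simp add: mul_zero_left minus_unique)

lemma star_zero: "star 0 = 0"
  using star_add[of 0 0] by simp

end

context right_module_over
begin

lemma act_zero_left: "0 \<lhd> a = 0"
  using act_add_left[of 0 0 a] by simp

lemma act_zero_right: "m \<lhd> 0 = 0"
  using act_add_right[of m 0 0] by simp

lemma act_diff_right: "m \<lhd> (a - b) = m \<lhd> a - m \<lhd> b"
  using act_add_right[of m "a - b" b] by (simp add: algebra_simps)

lemma real_scale_act: "real_scale r m \<lhd> a = real_scale r (m \<lhd> a)"
  by (simp add: real_scale_def flip: act_mul)
     (simp add: mul_scale_left mul_scale_right one_left one_right)

lemma real_scale_zero: "real_scale r 0 = 0"
  by (simp add: real_scale_def act_zero_left)

end

context real_metric_calculus
begin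

lemma h_zero_right: "h m 0 = 0"
  using h_add_right[of m 0 0] by simp

lemma h_zero_left: "h 0 n = 0"
  using h_star[of 0 n] by (simp add: h_zero_right star_zero)

lemma h_add_left: "h (m + m') n = h m n + h m' n"
  by (metis h_star h_add_right star_add)

lemma h_diff_left: "h (m - m') n = h m n - h m' n"
  using h_add_left[of "m - m'" m' n] by (simp add: algebra_simps)

lemma h_act_left: "h (m \<lhd> a) n = star a \<odot> h m n"
  by (metis h_star h_act_right star_mul)

lemma phi_induct:
  assumes "\<And>x. Q (\<phi> x)"
    and "\<And>m n. Q m \<Longrightarrow> Q n \<Longrightarrow> Q (m + n)"
    and "\<And>m a. Q m \<Longrightarrow> Q (m \<lhd> a)"
  shows "Q m"
proof -
  have "Q 0" using assms(3)[OF assms(1), of undefined 0] by (simp add: act_zero_right)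
  then have "submodule (Collect Q)" using assms(2,3) by (simp add: submodule_def)
  moreover have "range \<phi> \<subseteq> Collect Q" using assms(1) by auto
  ultimately have "submodule hull range \<phi> \<subseteq> Collect Q" by (rule hull_minimal[rotated])
  then show ?thesis using phi_generates by auto
qed

lemma eq_if_h_phi_eq:
  assumes "\<And>z. h m (\<phi> z) = h m' (\<phi> z)"
  shows "m = m'"
proof -
  have "h (m - m') n = 0" for n
    by (rule phi_induct[of "\<lambda>n. h (m - m') n = 0"])
       (simp_all add: h_diff_left assms h_add_right h_act_right mul_zero_left)
  then show ?thesis using h_nondegenerate by fastforce
qed

end

text \<open>As \<open>\<phi> z\<close> is fixed by \<open>P\<close>, the element \<open>h (\<nabla>\<^sub>x \<phi> y) (\<phi> z)\<close> is unchanged by multiplication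
  with \<open>P\<close> from the right and, being self-adjoint, also from the left. Hence \<open>\<nabla>\<^sub>x \<phi> y\<close> and \<open>(\<nabla>\<^sub>x \<phi> y) P\<close> have the same
  products with all \<open>\<phi> z\<close>.\<close>

lemma (in real_connection_calculus) connection_kills_derivative_of_projection:
  assumes P: "self_adjoint P" and fixed: "\<And>y. \<phi> y \<lhd> P = \<phi> y"
  shows "\<phi> y \<lhd> D x P = 0"
proof -
  have "nabla x (\<phi> y) = nabla x (\<phi> y) \<lhd> P"
  proof (rule eq_if_h_phi_eq)
    fix z
    let ?s = "h (nabla x (\<phi> y)) (\<phi> z)"
    have "?s = ?s \<odot> P" using h_act_right[of "nabla x (\<phi> y)" "\<phi> z" P] by (simp add: fixed)
    then have "star ?s = star P \<odot> star ?s" using star_mul by metis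
    then have "?s = star P \<odot> ?s"
      using h_nabla_self_adjoint by (simp add: self_adjoint_def)
    then show "?s = h (nabla x (\<phi> y) \<lhd> P) (\<phi> z)" by (simp add: h_act_left)
  qed
  moreover have "nabla x (\<phi> y) = nabla x (\<phi> y) \<lhd> P + \<phi> y \<lhd> D x P"
    using nabla_leibniz[of x "\<phi> y" P] by (simp add: fixed)
  ultimately show ?thesis by simp
qed

text \<open>This is the classical alternating sum of three metricity identities. It survives over a
  noncommutative algebra because self-adjointness of \<open>h (\<nabla>\<^sub>x \<phi> z) (\<phi> y)\<close> allows its two
  arguments to be exchanged, as for a symmetric form.\<close>

lemma (in pseudo_riemannian_calculus) koszul_formula:
  "h (nabla x (\<phi> y)) (\<phi> z) + h (nabla x (\<phi> y)) (\<phi> z) =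
     D x (h (\<phi> y) (\<phi> z)) + D y (h (\<phi> x) (\<phi> z)) - D z (h (\<phi> x) (\<phi> y))
     + h (\<phi> (bracket x y)) (\<phi> z) - h (\<phi> (bracket x z)) (\<phi> y) - h (\<phi> (bracket y z)) (\<phi> x)"
proof -
  have metric: "D x (h (\<phi> y) (\<phi> z)) = h (nabla x (\<phi> y)) (\<phi> z) + h (nabla x (\<phi> z)) (\<phi> y)" for x y z
    using nabla_metric[of x "\<phi> y" "\<phi> z"] h_star[of "\<phi> y" "nabla x (\<phi> z)"]
      h_nabla_self_adjoint[of x z y] by (simp add: self_adjoint_def)
  have torsion: "h (nabla x (\<phi> y)) (\<phi> z) = h (nabla y (\<phi> x)) (\<phi> z) + h (\<phi> (bracket x y)) (\<phi> z)"
    for x y z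
    using nabla_torsion_free[of x y] h_add_left
    by (metis diff_add_cancel eq_iff_diff_eq_0 add.commute)
  show ?thesis
    unfolding metric by (simp add: torsion[of x y] torsion[of x z] torsion[of y z] algebra_simps)
qed

lemma (in real_metric_calculus) levi_civita_unique:
  assumes "pseudo_riemannian_calculus scale mul one star act bracket D \<phi> h nabla"
    and "pseudo_riemannian_calculus scale mul one star act bracket D \<phi> h nabla'"
  shows "nabla = nabla'"
proof (intro ext)
  fix x m
  interpret L: pseudo_riemannian_calculus scale mul one star act bracket D \<phi> h nabla by fact
  interpret R: pseudo_riemannian_calculus scale mul one star act bracket D \<phi> h nabla' by fact
  have double_cancel: "a = b" if "a + a = b + b" for a b :: 'a
  proof -
    have "scale (1 + 1) a = scale (1 + 1) b"
      using that by (simp only: scale_left_distrib scale_one)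
    then show ?thesis by (metis scale_left_imp_eq one_add_one zero_neq_numeral)
  qed
  show "nabla x m = nabla' x m"
  proof (rule phi_induct[of "\<lambda>m. nabla x m = nabla' x m"])
    show "nabla x (\<phi> y) = nabla' x (\<phi> y)" for y
      by (rule eq_if_h_phi_eq, rule double_cancel, rule trans, rule L.koszul_formula,
          rule R.koszul_formula[symmetric])
    show "nabla x (m + n) = nabla' x (m + n)"
      if "nabla x m = nabla' x m" "nabla x n = nabla' x n" for m n
      using that L.nabla_add_right R.nabla_add_right by metis
    show "nabla x (m \<lhd> a) = nabla' x (m \<lhd> a)" if "nabla x m = nabla' x m" for m a
      using that L.nabla_leibniz R.nabla_leibniz by metis
  qed
qed

text \<open>Every \<open>\<phi> y\<close> is parallel for this connection, so the torsion reduces to the bracket; the metric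
  identity is the statement that \<open>D x\<close> is the commutator with an anti-hermitian element.\<close>

lemma (in real_metric_calculus) right_multiplication_pseudo_riemannian:
  assumes abelian: "\<And>x y. bracket x y = 0"
    and B_add: "\<And>x y. B (x + y) = B x + B y"
    and B_scaleR: "\<And>r x. B (r *\<^sub>R x) = scale (complex_of_real r) (B x)"
    and B_star: "\<And>x. star (B x) = - B x"
    and B_inner: "\<And>x a. D x a = a \<odot> B x - B x \<odot> a"
    and B_parallel: "\<And>x y. \<phi> y \<lhd> B x = 0"
  shows "pseudo_riemannian_calculus scale mul one star act bracket D \<phi> h (\<lambda>x m. m \<lhd> B x)"
proof unfold_locales
  have phi_0: "\<phi> 0 = 0" using phi_add[of 0 0] by simp
  fix x y z m n a r
  show "(m + n) \<lhd> B x = m \<lhd> B x + n \<lhd> B x" by (rule act_add_left)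
  show "m \<lhd> B (x + y) = m \<lhd> B x + m \<lhd> B y" by (simp add: B_add act_add_right)
  show "m \<lhd> B (r *\<^sub>R x) = real_scale r (m \<lhd> B x)"
    by (simp add: B_scaleR real_scale_def mul_scale_right one_right flip: act_mul)
  show "m \<lhd> a \<lhd> B x = m \<lhd> B x \<lhd> a + m \<lhd> D x a"
    by (simp add: B_inner act_diff_right act_mul)
  show "self_adjoint (h (\<phi> y \<lhd> B x) (\<phi> z))"
    by (simp add: B_parallel h_zero_left self_adjoint_def star_zero)
  show "D x (h m n) = h (m \<lhd> B x) n + h m (n \<lhd> B x)"
    by (simp add: B_inner h_act_left h_act_right B_star mul_minus_left)
  show "\<phi> y \<lhd> B x - \<phi> x \<lhd> B y - \<phi> (bracket x y) = 0"
    by (simp add: B_parallel abelian phi_0)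
qed


section \<open>Derivations of the matrix algebra\<close>

interpretation mat: unital_star_algebra mat_scale "(**)" "mat 1"
  "conj_transpose :: complex^'N^'N \<Rightarrow> complex^'N^'N"
  by (rule unital_star_algebra_mat)

interpretation row: right_module_over mat_scale "(**)" "mat 1"
  "conj_transpose :: complex^'N^'N \<Rightarrow> complex^'N^'N" "row_act :: complex^'N^'n \<Rightarrow> _"
  by (rule right_module_over_mat)

definition matrix_unit :: "'N \<Rightarrow> 'N \<Rightarrow> complex^'N^'N" where
  "matrix_unit i j = (\<chi> k l. if k = i \<and> l = j then 1 else 0)"

lemma mult_matrix_unit: "(A ** matrix_unit i j) $ k $ l = (if l = j then A $ k $ i else 0)"
  by (simp add: matrix_matrix_mult_def matrix_unit_def if_distrib[of "\<lambda>x. _ * x"] cong: if_cong)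

lemma matrix_unit_mult: "(matrix_unit i j ** A) $ k $ l = (if k = i then A $ j $ l else 0)"
  by (simp add: matrix_matrix_mult_def matrix_unit_def if_distrib[of "\<lambda>x. x * _"] cong: if_cong)

lemma mat_sum_left:
  fixes f :: "'k \<Rightarrow> complex^'N^'N" and A :: "complex^'N^'N"
  shows "(\<Sum>k\<in>K. f k) ** A = (\<Sum>k\<in>K. f k ** A)"
  by (induction K rule: infinite_finite_induct) (simp_all add: mat.mul_add_left mat.mul_zero_left)

lemma mat_sum_right:
  fixes f :: "'k \<Rightarrow> complex^'N^'N" and A :: "complex^'N^'N"
  shows "A ** (\<Sum>k\<in>K. f k) = (\<Sum>k\<in>K. A ** f k)"
  by (induction K rule: infinite_finite_induct) (simp_all add: mat.mul_add_right mat.mul_zero_right)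

text \<open>The implementing matrix is \<open>X = \<Sum>k. d E\<^sub>k\<^sub>r E\<^sub>r\<^sub>k\<close> for a fixed index \<open>r\<close>. Moving
  \<open>A\<close> past \<open>d\<close> by the Leibniz rule turns \<open>A X\<close> into \<open>\<Sum>k. d (A E\<^sub>k\<^sub>r) E\<^sub>r\<^sub>k - d A\<close>, and expanding
  both products in matrix units identifies the sum with \<open>X A\<close>.\<close>

lemma matrix_derivation_inner:
  assumes "mat.derivation (d :: complex^'N^'N \<Rightarrow> complex^'N^'N)"
  obtains X where "\<And>A. d A = X ** A - A ** X"
proof -
  have add: "d (A + B) = d A + d B" and scale: "d (mat_scale z A) = mat_scale z (d A)"
    and leibniz: "d (A ** B) = d A ** B + A ** d B" for A B z
    using assms by (auto simp: mat.derivation_def)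
  have zero: "d 0 = 0" using add[of 0 0] by simp
  have d_sum: "d (\<Sum>k\<in>K. f k) = (\<Sum>k\<in>K. d (f k))" for K :: "'N set" and f
    by (induction K rule: infinite_finite_induct) (simp_all add: zero add)
  define r :: 'N where "r = undefined"
  define X where "X = (\<Sum>k\<in>UNIV. d (matrix_unit k r) ** matrix_unit r k)"
  have "d A = X ** A - A ** X" for A
  proof -
    have resolution: "(\<Sum>k\<in>UNIV. matrix_unit k r ** matrix_unit r k) = (mat 1 :: complex^'N^'N)"
      by (simp add: vec_eq_iff mult_matrix_unit mat_def)
         (simp add: matrix_unit_def if_distrib if_distribR cong: if_cong)
    have column: "A ** matrix_unit k r = (\<Sum>l\<in>UNIV. mat_scale (A $ l $ k) (matrix_unit l r))" for k
      by (simp add: vec_eq_iff mult_matrix_unit mat_scale_def)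
         (simp add: matrix_unit_def if_distrib if_distribR cong: if_cong)
    have row: "matrix_unit r l ** A = (\<Sum>k\<in>UNIV. mat_scale (A $ l $ k) (matrix_unit r k))" for l
      by (simp add: vec_eq_iff matrix_unit_mult mat_scale_def)
         (simp add: matrix_unit_def if_distrib if_distribR cong: if_cong)
    have "d A + A ** X = (\<Sum>k\<in>UNIV. (d A ** matrix_unit k r + A ** d (matrix_unit k r)) ** matrix_unit r k)"
      by (simp add: X_def mat.mul_add_left sum.distrib mat_sum_right mat.mul_assoc resolution
          flip: mat_sum_right[of "d A"])
    also have "\<dots> = (\<Sum>k\<in>UNIV. d (A ** matrix_unit k r) ** matrix_unit r k)"
      by (simp add: leibniz)
    also have "\<dots> = (\<Sum>k\<in>UNIV. \<Sum>l\<in>UNIV. mat_scale (A $ l $ k) (d (matrix_unit l r) ** matrix_unit r k))"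
      by (simp add: column d_sum scale mat_sum_left mat.mul_scale_left)
    also have "\<dots> = (\<Sum>l\<in>UNIV. \<Sum>k\<in>UNIV. mat_scale (A $ l $ k) (d (matrix_unit l r) ** matrix_unit r k))"
      by (rule sum.swap)
    also have "\<dots> = X ** A"
      by (simp add: X_def mat_sum_left mat.mul_assoc row mat_sum_right mat.mul_scale_right)
    finally show ?thesis by (simp add: eq_diff_eq)
  qed
  then show ?thesis by (rule that)
qed

lemma trace_free_commuting_eq_0:
  assumes "trace Y = 0" and "\<And>A. Y ** A = A ** (Y :: complex^'N^'N)"
  shows "Y = 0"
proof -
  have entry: "Y $ k $ i = (if k = i then Y $ j $ j else 0)" for k i j
    using arg_cong[OF assms(2)[of "matrix_unit i j"], of "\<lambda>M. M $ k $ j"]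
    by (simp add: mult_matrix_unit matrix_unit_mult)
  have "Y $ i $ i = Y $ j $ j" for i j using entry[of i i j] by simp
  then have "trace Y = of_nat CARD('N) * Y $ j $ j" for j
    unfolding trace_def by (metis (no_types, lifting) sum.cong sum_constant)
  then have "Y $ j $ j = 0" for j using assms(1) by simp
  then have "Y $ k $ i = 0" for k i using entry[of k i k] by (simp only: if_cancel)
  then show ?thesis by (simp add: vec_eq_iff)
qed

lemma trace_free_matrix_eqI:
  assumes "trace X = 0" and "\<And>A. d A = X ** A - A ** X"
  shows "trace_free_matrix d = (X :: complex^'N^'N)"
  unfolding trace_free_matrix_def
proof (rule the_equality)
  show "trace X = 0 \<and> (\<forall>A. d A = X ** A - A ** X)" using assms by simp
  fix Z assume Z: "trace Z = 0 \<and> (\<forall>A. d A = Z ** A - A ** Z)"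
  have "Z - X = 0"
  proof (rule trace_free_commuting_eq_0)
    show "trace (Z - X) = 0" using Z assms(1) by (simp add: trace_sub)
    fix A
    have "Z ** A - A ** Z = X ** A - A ** X" using Z assms(2) by metis
    then show "(Z - X) ** A = A ** (Z - X)"
      using mat.mul_add_left[of "Z - X" X A] mat.mul_add_right[of A "Z - X" X]
      by (simp add: algebra_simps)
  qed
  then show "Z = X" by simp
qed

lemma trace_mat_scale: "trace (mat_scale z A) = z * trace A"
  by (simp add: trace_def mat_scale_def sum_distrib_left)

lemma trace_free_matrix_implements:
  assumes "mat.derivation (d :: complex^'N^'N \<Rightarrow> complex^'N^'N)"
  shows "trace (trace_free_matrix d) = 0"
    and "d A = trace_free_matrix d ** A - A ** trace_free_matrix d"
proof -
  obtain X where X: "\<And>A. d A = X ** A - A ** X" using matrix_derivation_inner[OF assms] by blast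
  define z where "z = - trace X / of_nat CARD('N)"
  define Y where "Y = X + mat_scale z (mat 1)"
  have 1: "trace Y = 0" by (simp add: Y_def z_def trace_add trace_sub trace_mat_scale trace_I)
  have 2: "d A = Y ** A - A ** Y" for A
    by (simp add: Y_def X mat.mul_add_left mat.mul_add_right mat.mul_scale_left mat.mul_scale_right
        mat.one_left mat.one_right)
  have "trace_free_matrix d = Y" by (rule trace_free_matrix_eqI) (rule 1, rule 2)
  then show "trace (trace_free_matrix d) = 0"
    "d A = trace_free_matrix d ** A - A ** trace_free_matrix d" using 1 2 by simp_all
qed

text \<open>Taking adjoints in \<open>d A\<^sup>* = (d A)\<^sup>*\<close> shows that \<open>- X\<^sup>*\<close> is another trace-free matrix
  implementing \<open>d\<close>.\<close>

lemma trace_free_matrix_antihermitian: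
  assumes "mat.hermitian_derivation (d :: complex^'N^'N \<Rightarrow> complex^'N^'N)"
  shows "conj_transpose (trace_free_matrix d) = - trace_free_matrix d"
proof -
  let ?X = "trace_free_matrix d"
  have der: "mat.derivation d" and herm: "d (conj_transpose A) = conj_transpose (d A)" for A
    using assms by (auto simp: mat.hermitian_derivation_def)
  have "?X = - conj_transpose ?X"
  proof (rule trace_free_matrix_eqI)
    have "trace (conj_transpose ?X) = cnj (trace ?X)"
      by (simp add: trace_def conj_transpose_def)
    then show "trace (- conj_transpose ?X) = 0"
      using trace_free_matrix_implements(1)[OF der] trace_sub[of 0 "conj_transpose ?X"]
      by (simp add: trace_0[unfolded mat_0])
    fix A
    have diff: "conj_transpose (U - V) = conj_transpose U - conj_transpose V" for U V :: "complex^'N^'N"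
      by (simp add: vec_eq_iff conj_transpose_def)
    have "d A = conj_transpose (d (conj_transpose A))"
      by (simp add: herm mat.star_star)
    then show "d A = (- conj_transpose ?X) ** A - A ** (- conj_transpose ?X)"
      using trace_free_matrix_implements(2)[OF der, of "conj_transpose A"]
      by (simp add: diff mat.star_mul mat.star_star mat.mul_minus_left mat.mul_minus_right)
  qed
  then show ?thesis by (metis minus_minus)
qed


section \<open>Row vectors\<close>

lemma row_act_axis: "row_act (axis i w) A = axis i (w v* A)"
  by (simp add: row_act_def axis_def vec_eq_iff)

lemma scaleR_vector_matrix_mult: "(r *\<^sub>R w) v* A = r *\<^sub>R (w v* (A :: complex^'N^'N))"
  by (simp add: vec_eq_iff vector_matrix_mult_def scaleR_sum_right)

lemma row_act_mat_scale: "row_act v (mat_scale z A) = row_scale z (row_act v A)"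
  by (simp add: vec_eq_iff row_act_def row_scale_def vector_matrix_mult_def mat_scale_def
      sum_distrib_left ac_simps)

definition hermitian_dot :: "complex^'N \<Rightarrow> complex^'N \<Rightarrow> complex" where
  "hermitian_dot u w = (\<Sum>k\<in>UNIV. u $ k * cnj (w $ k))"

lemma hermitian_dot_self: "hermitian_dot w w = complex_of_real ((norm w)\<^sup>2)"
  by (simp add: hermitian_dot_def norm_vec_def L2_set_def sum_nonneg flip: complex_norm_square)

definition line_projection :: "complex^'N \<Rightarrow> complex^'N^'N" where
  "line_projection w = (\<chi> k l. cnj (w $ k) * w $ l)"

lemma line_projection_apply: "u v* line_projection w = hermitian_dot u w *s w"
  by (simp add: vec_eq_iff vector_matrix_mult_def line_projection_def hermitian_dot_def
      sum_distrib_left sum_distrib_right ac_simps)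

lemma line_projection_self_adjoint: "mat.self_adjoint (line_projection w)"
  by (simp add: mat.self_adjoint_def vec_eq_iff conj_transpose_def line_projection_def ac_simps)

lemma cnj_hermitian_dot_antihermitian:
  assumes "conj_transpose X = - X"
  shows "cnj (hermitian_dot (w v* X) w) = - hermitian_dot (w v* X) w"
proof -
  have X: "cnj (X $ j $ k) = - X $ k $ j" for j k
    using arg_cong[OF assms, of "\<lambda>M. M $ k $ j"] by (simp add: conj_transpose_def)
  have "cnj (hermitian_dot (w v* X) w) =
      (\<Sum>k\<in>UNIV. \<Sum>j\<in>UNIV. - (X $ k $ j * cnj (w $ j) * w $ k))"
    by (simp add: hermitian_dot_def vector_matrix_mult_def X sum_distrib_left ac_simps)
  also have "\<dots> = (\<Sum>j\<in>UNIV. \<Sum>k\<in>UNIV. - (X $ k $ j * cnj (w $ j) * w $ k))"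
    by (rule sum.swap)
  also have "\<dots> = - hermitian_dot (w v* X) w"
    by (simp add: hermitian_dot_def vector_matrix_mult_def sum_distrib_left sum_negf ac_simps)
  finally show ?thesis .
qed


section \<open>The Levi-Civita connection\<close>

theorem proposition4p12:
  fixes bracket :: "'g::real_vector \<Rightarrow> 'g \<Rightarrow> 'g"
    and \<delta> :: "'n::finite \<Rightarrow> 'g"
    and D :: "'g \<Rightarrow> complex^'N^'N \<Rightarrow> complex^'N^'N"
    and \<phi> :: "'g \<Rightarrow> complex^'N^'n"
    and h :: "complex^'N^'n \<Rightarrow> complex^'N^'n \<Rightarrow> complex^'N^'N"
    and \<alpha> :: "'n \<Rightarrow> real"
    and v0 :: "complex^'N"
  assumes "real_metric_calculus mat_scale (**) (mat 1) conj_transpose row_act bracket D \<phi> h"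
    and "\<And>x y. bracket x y = 0"
    and "inj \<delta>" and "independent (range \<delta>)" and "span (range \<delta>) = UNIV"
    and "norm v0 = 1"
    and "\<And>i. \<alpha> i \<noteq> 0"
    and "\<And>i. \<phi> (\<delta> i) = axis i (\<alpha> i *\<^sub>R v0)"
  shows "((\<exists>!nabla. pseudo_riemannian_calculus mat_scale (**) (mat 1) conj_transpose row_act
            bracket D \<phi> h nabla) \<longleftrightarrow> (\<forall>i. \<exists>c. v0 v* trace_free_matrix (D (\<delta> i)) = c *s v0))
    \<and> (\<forall>lam nabla. (\<forall>i. v0 v* trace_free_matrix (D (\<delta> i)) = lam i *s v0) \<longrightarrow>
          pseudo_riemannian_calculus mat_scale (**) (mat 1) conj_transpose row_act
            bracket D \<phi> h nabla \<longrightarrow>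
          (\<forall>i v. nabla (\<delta> i) v = row_scale (lam i) v - row_act v (trace_free_matrix (D (\<delta> i)))))"
proof -
  interpret C: real_metric_calculus mat_scale "(**)" "mat 1"
    "conj_transpose :: complex^'N^'N \<Rightarrow> complex^'N^'N" row_act bracket D \<phi> h
    by fact
  note abelian = assms(2) and spanning = assms(5) and unit = assms(6)
    and \<alpha>_nonzero = assms(7) and \<phi>_basis = assms(8)
  let ?PR = "pseudo_riemannian_calculus mat_scale (**) (mat 1) conj_transpose row_act bracket D \<phi> h"
  define X where "X x = trace_free_matrix (D x)" for x
  have v0_dot: "hermitian_dot v0 v0 = 1" by (simp add: hermitian_dot_self unit)

  have der: "mat.derivation (D x)" for x
    using C.D_hermitian by (simp add: mat.hermitian_derivation_def)
  have X_inner: "D x A = X x ** A - A ** X x" for x A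
    unfolding X_def by (rule trace_free_matrix_implements(2)[OF der])
  have X_trace: "trace (X x) = 0" for x
    unfolding X_def by (rule trace_free_matrix_implements(1)[OF der])
  have X_star: "conj_transpose (X x) = - X x" for x
    unfolding X_def by (rule trace_free_matrix_antihermitian[OF C.D_hermitian])
  have X_add: "X (x + y) = X x + X y" for x y
    unfolding X_def[of "x + y"]
    by (rule trace_free_matrix_eqI)
       (simp_all add: trace_add X_trace C.D_add X_inner[of x] X_inner[of y] mat.mul_add_left mat.mul_add_right)
  have X_scaleR: "X (r *\<^sub>R x) = mat_scale (complex_of_real r) (X x)" for r x
    unfolding X_def[of "r *\<^sub>R x"]
    by (rule trace_free_matrix_eqI)
       (simp_all add: trace_mat_scale X_trace C.D_scaleR X_inner[of x] mat.mul_scale_left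
         mat.mul_scale_right mat.scale_right_diff_distrib)

  have \<phi>_spanI: "Q (\<phi> y)"
    if basis: "\<And>i. Q (\<phi> (\<delta> i))" and zero: "Q 0"
      and add: "\<And>m n. Q m \<Longrightarrow> Q n \<Longrightarrow> Q (m + n)" and scale: "\<And>r m. Q m \<Longrightarrow> Q (row.real_scale r m)"
    for Q y
  proof -
    have \<phi>_0: "\<phi> 0 = 0" using C.phi_add[of 0 0] by simp
    have "y \<in> span (range \<delta>)" using spanning by simp
    then show ?thesis
      by (induction rule: span_induct_alt) (auto simp: \<phi>_0 C.phi_add C.phi_scaleR intro: basis zero add scale)
  qed
  have row_act_basis: "row_act (\<phi> (\<delta> i)) A = axis i (\<alpha> i *\<^sub>R (v0 v* A))" for i A
    by (simp add: \<phi>_basis row_act_axis scaleR_vector_matrix_mult)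

  have necessary: "\<exists>c. v0 v* X (\<delta> i) = c *s v0" if "?PR nabla" for nabla i
  proof -
    interpret L: pseudo_riemannian_calculus mat_scale "(**)" "mat 1"
      "conj_transpose :: complex^'N^'N \<Rightarrow> complex^'N^'N" row_act bracket D \<phi> h nabla
      by fact
    let ?P = "line_projection v0"
    have P_v0: "v0 v* ?P = v0" by (simp add: line_projection_apply v0_dot)
    have "row_act (\<phi> y) ?P = \<phi> y" for y
      by (rule \<phi>_spanI)
         (simp_all add: row_act_axis scaleR_vector_matrix_mult P_v0 \<phi>_basis row.act_zero_left
           row.act_add_left row.real_scale_act)
    then have "row_act (\<phi> (\<delta> i)) (D (\<delta> i) ?P) = 0"
      by (intro L.connection_kills_derivative_of_projection line_projection_self_adjoint)
    then have "row_act (\<phi> (\<delta> i)) (X (\<delta> i) ** ?P) = row_act (\<phi> (\<delta> i)) (?P ** X (\<delta> i))"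
      by (simp add: X_inner row.act_diff_right)
    then have "v0 v* X (\<delta> i) v* ?P = v0 v* ?P v* X (\<delta> i)"
      using \<alpha>_nonzero[of i] by (auto simp: row_act_basis axis_eq_axis vector_matrix_mul_assoc)
    then show ?thesis by (metis P_v0 line_projection_apply)
  qed

  \<comment> \<open>Since \<open>v0\<close> is a unit vector, the eigenvalue for \<open>X x\<close> can only be this number, and defining it
    thus makes it real linear in \<open>x\<close> without reference to a basis.\<close>
  define eigenvalue where "eigenvalue x = hermitian_dot (v0 v* X x) v0" for x
  define B where "B x = mat_scale (eigenvalue x) (mat 1) - X x" for x
  have eigenvalue_eq: "eigenvalue (\<delta> i) = c" if "v0 v* X (\<delta> i) = c *s v0" for i c
    using that v0_dot by (simp add: eigenvalue_def hermitian_dot_def mult.assoc flip: sum_distrib_left)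

  have sufficient: "?PR (\<lambda>x m. row_act m (B x))" if eigen: "\<forall>i. \<exists>c. v0 v* X (\<delta> i) = c *s v0"
  proof (rule C.right_multiplication_pseudo_riemannian)
    show "bracket x y = 0" for x y by (rule abelian)
    show B_add: "B (x + y) = B x + B y" for x y
      by (simp add: B_def eigenvalue_def X_add hermitian_dot_def vector_matrix_mult_def mat_scale_def
          vec_eq_iff algebra_simps sum.distrib)
    show B_scaleR: "B (r *\<^sub>R x) = mat_scale (complex_of_real r) (B x)" for r x
      by (simp add: B_def eigenvalue_def X_scaleR hermitian_dot_def vector_matrix_mult_def mat_scale_def
          vec_eq_iff algebra_simps sum_distrib_left)
    have "cnj (eigenvalue x) = - eigenvalue x" for x
      unfolding eigenvalue_def by (rule cnj_hermitian_dot_antihermitian[OF X_star])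
    moreover have "cnj (X x $ j $ i) = - X x $ i $ j" for x i j
      using arg_cong[OF X_star[of x], of "\<lambda>M. M $ i $ j"] by (simp add: conj_transpose_def)
    ultimately show "conj_transpose (B x) = - B x" for x
      by (simp add: B_def vec_eq_iff conj_transpose_def mat_scale_def mat_def)
    show "D x A = A ** B x - B x ** A" for x A
    proof -
      have "A ** B x = mat_scale (eigenvalue x) A - A ** X x"
        using mat.mul_add_right[of A "B x" "X x"]
        by (simp add: B_def mat.mul_scale_right mat.one_right eq_diff_eq)
      moreover have "B x ** A = mat_scale (eigenvalue x) A - X x ** A"
        using mat.mul_add_left[of "B x" "X x" A]
        by (simp add: B_def mat.mul_scale_left mat.one_left eq_diff_eq)
      ultimately show ?thesis by (simp add: X_inner)
    qed
    have v0_basis: "v0 v* B (\<delta> i) = 0" for i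
    proof -
      obtain c where c: "v0 v* X (\<delta> i) = c *s v0" using eigen by blast
      have "v0 v* B (\<delta> i) = eigenvalue (\<delta> i) *s v0 - v0 v* X (\<delta> i)"
        by (simp add: B_def vec_eq_iff vector_matrix_mult_def mat_scale_def mat_def algebra_simps
            sum_subtractf if_distrib[of "\<lambda>t. _ * t"] cong: if_cong)
      then show ?thesis by (simp add: c eigenvalue_eq)
    qed
    show "row_act (\<phi> y) (B x) = 0" for x y
    proof (rule \<phi>_spanI)
      have B_0: "B 0 = 0" using B_add[of 0 0] by simp
      have "x \<in> span (range \<delta>)" using spanning by simp
      then have "v0 v* B x = 0"
      proof (induction rule: span_induct_alt)
        case base
        show ?case by (simp add: B_0 vec_eq_iff vector_matrix_mult_def)
      next
        case (step r x y)
        have "v0 v* B (r *\<^sub>R x + y) = complex_of_real r *s (v0 v* B x) + v0 v* B y"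
          by (simp add: B_add B_scaleR vec_eq_iff vector_matrix_mult_def mat_scale_def algebra_simps
              sum.distrib sum_distrib_left)
        with step v0_basis show ?case by auto
      qed
      then show "row_act (\<phi> (\<delta> i)) (B x) = 0" for i by (simp add: row_act_basis)
    qed (simp_all add: row.act_zero_left row.act_add_left row.real_scale_act row.real_scale_zero)
  qed

  have formula: "nabla (\<delta> i) v = row_scale (lam i) v - row_act v (X (\<delta> i))"
    if lam: "\<forall>i. v0 v* X (\<delta> i) = lam i *s v0" and nabla: "?PR nabla" for lam nabla i v
  proof -
    have "nabla = (\<lambda>x m. row_act m (B x))"
      using lam by (intro C.levi_civita_unique[OF nabla] sufficient) blast
    then show ?thesis
      using eigenvalue_eq[of i "lam i"] lam
      by (simp add: B_def row.act_diff_right row_act_mat_scale row.act_one)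
  qed
  have "(\<exists>!nabla. ?PR nabla) \<longleftrightarrow> (\<forall>i. \<exists>c. v0 v* X (\<delta> i) = c *s v0)"
  proof
    assume "\<exists>!nabla. ?PR nabla"
    then show "\<forall>i. \<exists>c. v0 v* X (\<delta> i) = c *s v0" using necessary by blast
  next
    assume "\<forall>i. \<exists>c. v0 v* X (\<delta> i) = c *s v0"
    then show "\<exists>!nabla. ?PR nabla"
      using sufficient by (intro ex1I[of _ "\<lambda>x m. row_act m (B x)"] C.levi_civita_unique)
  qed
  with formula show ?thesis unfolding X_def by blast
qed

end
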